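(* Assume $P\in[0,1)$ and $\lim_{x\uparrow 1/P}F(x)=\infty$. Let $\gamma\in\mathbb{R}$ be fixed and let $\lambda=s-\gamma\sqrt{s}$ (with $s$ large enough that $\gamma_P<\gamma\le\sqrt{s}$). Then $$\lim_{s\to\infty}\sqrt{s}\,D_F(s,s-\gamma\sqrt{s})=(1+F(1))\frac{\varphi(\gamma)}{\Phi(\gamma)},\qquad \lim_{s\to\infty}\sqrt{s}\,D_F^R(s,s-\gamma\sqrt{s})=\frac{\varphi(\gamma)}{\Phi(\gamma)}.$$
   Context: $\Phi$ and $\varphi$ are the standard normal distribution function and density. $s\ge1$ is an integer (number of servers) and $(p_k)_{k\ge s}$ is a sequence in $[0,1]$ (admission policy). The numbers $p_{s+n}$, $n\ge 0$, do not depend on $s$ (i.e. $p_{s+n}=q_n$ for a fixed sequence $(q_n)_{n\ge0}$ in $[0,1]$), so that the power series $F(x)=\sum_{n=0}^{\infty}p_s\cdots p_{s+n}\,x^{n+1}$ and the number $P=\limsup_{n\to\infty}(p_s\cdots p_{s+n})^{1/(n+1)}\in[0,1]$ do not depend on $s$. The radius of convergence of $F$ is $1/P$ ($=\infty$ if $P=0$). Put $\lambda_P=s/P$ ($=\infty$ if $P=0$) and $\gamma_P=-\frac{1-P}{P}\sqrt{s}$ ($=-\infty$ if $P=0$). The Erlang B function is $B(s,\lambda)=\dfrac{\lambda^s/s!}{\sum_{k=0}^s\lambda^k/k!}$. For $0<\lambda<\lambda_P$ define $$D_F(s,\lambda)=\frac{1+F(\lambda/s)}{B(s,\lambda)^{-1}+F(\lambda/s)},\qquad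 D_F^R(s,\lambda)=\frac{1+(1-s/\lambda)F(\lambda/s)}{B(s,\lambda)^{-1}+F(\lambda/s)},$$ with $D_F(s,0)=D_F^R(s,0)=0$. (These are the stationary probabilities that an arriving customer finds all servers occupied, respectively is rejected, in the birth-death queue with birth rates $\lambda$ for $k<s$ and $\lambda p_k$ for $k\ge s$, and death rates $\min(k,s)$.) *)

theory Defs
  imports "HOL-Probability.Probability"
begin

text \<open>
  The admission policy of the queue with \<open>s\<close> servers is \<open>p\<^sub>s\<^sub>+\<^sub>n = q n\<close>, with one sequence
  \<open>q :: nat \<Rightarrow> real\<close> for all \<open>s\<close>. Hence \<open>p\<^sub>s \<cdots> p\<^sub>s\<^sub>+\<^sub>n\<close> is the product of \<open>q 0, \<dots>, q n\<close>.
\<close>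

definition adm_prod :: "(nat \<Rightarrow> real) \<Rightarrow> nat \<Rightarrow> real" where
  "adm_prod q n = (\<Prod>k\<le>n. q k)"

definition adm_F :: "(nat \<Rightarrow> real) \<Rightarrow> real \<Rightarrow> real" where
  "adm_F q x = (\<Sum>n. adm_prod q n * x ^ Suc n)"

text \<open>The limsup is taken in \<^typ>\<open>ereal\<close>; it lies in \<open>[0,1]\<close> whenever \<open>q\<close> takes values in \<open>[0,1]\<close>.\<close>

definition adm_P :: "(nat \<Rightarrow> real) \<Rightarrow> real" where
  "adm_P q = real_of_ereal (limsup (\<lambda>n. ereal (root (Suc n) (adm_prod q n))))"

text \<open>The filter of \<open>x\<close> increasing to the radius of convergence \<open>1/P\<close>, which is \<open>\<infinity>\<close> for \<open>P = 0\<close>.\<close>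

definition at_left_radius :: "(nat \<Rightarrow> real) \<Rightarrow> real filter" where
  "at_left_radius q = (if adm_P q = 0 then at_top else at_left (1 / adm_P q))"

definition gamma_P :: "(nat \<Rightarrow> real) \<Rightarrow> nat \<Rightarrow> ereal" where
  "gamma_P q s = (if adm_P q = 0 then -\<infinity> else ereal (- ((1 - adm_P q) / adm_P q) * sqrt (real s)))"

definition erlang_B :: "nat \<Rightarrow> real \<Rightarrow> real" where
  "erlang_B s l = (l ^ s / fact s) / (\<Sum>k\<le>s. l ^ k / fact k)"

text \<open>
  \<open>D_F\<close> and \<open>D_F_R\<close> are meaningful for \<open>s \<ge> 1\<close>, \<open>0 \<le> \<lambda>\<close> and \<open>\<lambda> < s / P\<close> only; at other
  arguments the formulas below carry no meaning.
\<close>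

definition D_F :: "(nat \<Rightarrow> real) \<Rightarrow> nat \<Rightarrow> real \<Rightarrow> real" where
  "D_F q s l =
    (if l = 0 then 0
     else (1 + adm_F q (l / real s)) / (inverse (erlang_B s l) + adm_F q (l / real s)))"

definition D_F_R :: "(nat \<Rightarrow> real) \<Rightarrow> nat \<Rightarrow> real \<Rightarrow> real" where
  "D_F_R q s l =
    (if l = 0 then 0
     else (1 + (1 - real s / l) * adm_F q (l / real s)) / (inverse (erlang_B s l) + adm_F q (l / real s)))"

text \<open>
  For \<open>\<lambda> = s - \<gamma> \<surd>s\<close>, the conditions \<open>0 \<le> \<lambda>\<close> and \<open>\<lambda> < s / P\<close> say \<open>\<gamma>\<^sub>P < \<gamma> \<le> \<surd>s\<close>. If \<open>P < 1\<close>,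
  this holds for all large \<open>s\<close>, so limits as \<open>s\<close> tends to infinity do not see the meaningless values.
\<close>

lemma eventually_gamma_in_range:
  assumes "0 \<le> adm_P q" and "adm_P q < 1"
  shows "\<forall>\<^sub>F s in sequentially. gamma_P q s < ereal \<gamma> \<and> \<gamma> \<le> sqrt (real s)"
proof -
  have lim: "filterlim (\<lambda>s. sqrt (real s)) at_top sequentially"
    by (rule filterlim_compose[OF sqrt_at_top filterlim_real_sequentially])
  have "\<forall>\<^sub>F s in sequentially. gamma_P q s < ereal \<gamma>"
  proof (cases "adm_P q = 0")
    case True
    then show ?thesis by (simp add: gamma_P_def)
  next
    case False
    define c where "c = (1 - adm_P q) / adm_P q"
    have c: "c > 0" using False assms by (simp add: c_def)
    have "\<forall>\<^sub>F s in sequentially. - \<gamma> / c < sqrt (real s)"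
      using lim by (simp add: filterlim_at_top_dense)
    then show ?thesis
      by eventually_elim (use False c in \<open>simp add: gamma_P_def flip: c_def\<close>, simp add: field_simps)
  qed
  moreover have "\<forall>\<^sub>F s in sequentially. \<gamma> \<le> sqrt (real s)"
    using lim by (simp add: filterlim_at_top)
  ultimately show ?thesis by (rule eventually_conj)
qed

end

theory Submission
  imports Defs "HOL-Real_Asymp.Real_Asymp"
begin

text \<open>
  Put \<open>l = s - \<gamma> \<surd>s\<close>. Multiplying either probability by \<open>\<surd>s\<close> divides its denominator by \<open>\<surd>s\<close>, and
  then everything follows from two limits. First, \<open>l / s\<close> tends to 1, a point strictly inside the disc of
  convergence of \<open>F\<close> because \<open>P < 1\<close>; so \<open>F (l / s)\<close> tends to \<open>F 1\<close> (\<open>isCont_adm_F_1\<close>) and its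
  share \<open>F (l / s) / \<surd>s\<close> of the denominator vanishes, as does the summand \<open>(1 - s / l) F (l / s)\<close>
  of the numerator for rejection. Second, the reciprocal of the Erlang B function divided by \<open>\<surd>s\<close>
  tends to \<open>\<Phi> \<gamma> / \<phi> \<gamma>\<close> (\<open>inverse_erlang_B_over_sqrt_tendsto\<close>).

  For the second limit, summing the truncated exponential series from its last term downwards gives
  \[ B(s,l)^{-1} = \sum_{j \le s} \frac{\prod_{i<j} (1 - i/s)}{(1 - \gamma/\sqrt s)^j}. \]
  For \<open>j\<close> close to \<open>y \<surd>s\<close> the numerator is about \<open>exp (- y\<^sup>2 / 2)\<close> and the denominator about
  \<open>exp (- \<gamma> y)\<close>. Hence the sum divided by \<open>\<surd>s\<close> is a Riemann sum of mesh \<open>1 / \<surd>s\<close> for the integral of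
  \<open>exp (\<gamma> y - y\<^sup>2 / 2)\<close> over the positive half line, which equals \<open>\<Phi> \<gamma> / \<phi> \<gamma>\<close> after completing the
  square. The range of \<open>y\<close> being unbounded, the passage to the limit is by dominated convergence,
  applied to the step functions \<open>erlang_step\<close> whose integrals are the Riemann sums.
\<close>

section \<open>The generating function near 1\<close>

lemma adm_prod_bounds:
  assumes "\<And>n. 0 \<le> q n \<and> q n \<le> 1"
  shows "0 \<le> adm_prod q n" "adm_prod q n \<le> 1"
  using assms unfolding adm_prod_def by (auto intro!: prod_nonneg prod_le_1)

text \<open>
  The definition of \<open>adm_P\<close> sends infinite values to 0; the limsup lies in \<open>[0,1]\<close>, so nothing
  is lost.
\<close>

lemma limsup_root_adm_prod:
  assumes "\<And>n. 0 \<le> q n \<and> q n \<le> 1"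
  shows "limsup (\<lambda>n. ereal (root (Suc n) (adm_prod q n))) = ereal (adm_P q)"
proof -
  let ?u = "\<lambda>n. ereal (root (Suc n) (adm_prod q n))"
  have "\<And>n. 0 \<le> ?u n \<and> ?u n \<le> 1"
    using adm_prod_bounds[OF assms] by simp
  then have "0 \<le> limsup ?u" "limsup ?u \<le> 1"
    by (auto intro!: le_Limsup Limsup_bounded always_eventually)
  then show ?thesis
    unfolding adm_P_def by (subst ereal_real) auto
qed

text \<open>
  As in the Cauchy--Hadamard theorem: for \<open>P < c < 1\<close> the coefficients are eventually below powers
  of \<open>c\<close>, so the series converges at some \<open>K > 1\<close>, hence is continuous at 1.
\<close>

lemma isCont_adm_F_1:
  assumes q: "\<And>n. 0 \<le> q n \<and> q n \<le> 1" and P: "0 \<le> adm_P q" "adm_P q < 1"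
  shows "isCont (adm_F q) 1"
proof -
  define c where "c = (1 + adm_P q) / 2"
  have c: "0 < c" "c < 1" "adm_P q < c" using P by (auto simp: c_def)
  obtain K where K: "1 < K" "K < 1 / c"
    using dense[of 1 "1 / c"] c by auto
  have cK: "\<bar>c * K\<bar> < 1" using K c by (simp add: field_simps)
  have "\<forall>\<^sub>F n in sequentially. ereal (root (Suc n) (adm_prod q n)) < ereal c"
    using c by (intro Limsup_lessD) (simp add: limsup_root_adm_prod[OF q])
  then have "\<forall>\<^sub>F n in sequentially. norm (adm_prod q n * K ^ n) \<le> c * (c * K) ^ n"
  proof eventually_elim
    case (elim n)
    have "adm_prod q n = root (Suc n) (adm_prod q n) ^ Suc n"
      using adm_prod_bounds[OF q] by (simp add: real_root_pow_pos2 del: power_Suc)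
    also have "\<dots> \<le> c ^ Suc n"
      using elim adm_prod_bounds(1)[OF q] by (intro power_mono) (auto simp: less_imp_le)
    finally have "adm_prod q n * K ^ n \<le> c ^ Suc n * K ^ n"
      using K by (intro mult_right_mono) auto
    moreover have "0 \<le> adm_prod q n * K ^ n"
      using adm_prod_bounds(1)[OF q] K by simp
    ultimately show ?case by (simp add: power_mult_distrib)
  qed
  then have sum: "summable (\<lambda>n. adm_prod q n * K ^ n)"
    by (rule summable_comparison_test_ev) (use cK in \<open>auto intro: summable_mult summable_geometric\<close>)
  have "isCont (\<lambda>x. (\<Sum>n. adm_prod q n * x ^ n) * x) 1"
    by (intro continuous_intros isCont_powser[OF sum]) (use K in auto)
  moreover have "\<forall>\<^sub>F x in nhds 1. adm_F q x = (\<Sum>n. adm_prod q n * x ^ n) * x"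
  proof -
    have "\<forall>\<^sub>F x in nhds 1. x \<in> {-K<..<K}"
      by (rule eventually_nhds_in_open) (use K in auto)
    then show ?thesis
    proof eventually_elim
      case (elim x)
      then have "summable (\<lambda>n. adm_prod q n * x ^ n)"
        by (intro powser_inside[OF sum]) auto
      then show ?case
        unfolding adm_F_def by (subst suminf_mult2) (auto simp: algebra_simps)
    qed
  qed
  ultimately show ?thesis by (subst isCont_cong)
qed

section \<open>The Erlang B function as an integral of a step function\<close>

text \<open>
  The summand of the reciprocal Erlang B function at \<open>l = s - \<gamma> \<surd>s\<close>: the term of index \<open>s - j\<close> of
  the truncated exponential series, relative to the last term.
\<close>

definition erlang_term :: "real \<Rightarrow> nat \<Rightarrow> nat \<Rightarrow> real" where
  "erlang_term \<gamma> s j = (\<Prod>i<j. 1 - real i / real s) / (1 - \<gamma> / sqrt (real s)) ^ j"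

lemma falling_factorial_fact:
  assumes "j \<le> s"
  shows "(\<Prod>i<j. real s - real i) = fact s / fact (s - j)"
  using assms
proof (induction j)
  case (Suc j)
  then have "fact (s - j) = (real s - real j) * fact (s - Suc j)"
    using fact_reduce[of "s - j", where 'a = real] by (simp add: of_nat_diff)
  with Suc show ?case by (simp add: field_simps)
qed simp

lemma inverse_erlang_B_eq_sum:
  assumes s: "s > 0" and g: "\<gamma> < sqrt (real s)"
  shows "inverse (erlang_B s (real s - \<gamma> * sqrt (real s))) = (\<Sum>j\<le>s. erlang_term \<gamma> s j)"
proof -
  define l where "l = real s - \<gamma> * sqrt (real s)"
  have "real s * (\<gamma> / sqrt (real s)) = \<gamma> * (real s / sqrt (real s))" by simp
  then have l_eq: "l = real s * (1 - \<gamma> / sqrt (real s))"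
    by (simp only: l_def right_diff_distrib real_div_sqrt of_nat_0_le_iff mult_1_right)
  have l: "l > 0" unfolding l_eq using s g by (simp add: field_simps)
  have reversed: "erlang_term \<gamma> s j = (l ^ (s - j) / fact (s - j)) / (l ^ s / fact s)" if "j \<le> s" for j
  proof -
    have "(\<Prod>i<j. 1 - real i / real s) = (\<Prod>i<j. (real s - real i) / real s)"
      using s by (intro prod.cong) (auto simp: field_simps)
    also have "\<dots> = (fact s / fact (s - j)) / real s ^ j"
      using falling_factorial_fact[OF that] by (simp add: prod_dividef)
    finally have "erlang_term \<gamma> s j = (fact s / fact (s - j)) / l ^ j"
      unfolding erlang_term_def l_eq by (simp add: power_mult_distrib)
    moreover have "l ^ s = l ^ (s - j) * l ^ j" using that by (simp flip: power_add)
    ultimately show ?thesis using l by simp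
  qed
  have "inverse (erlang_B s l) = (\<Sum>k\<le>s. l ^ k / fact k) / (l ^ s / fact s)"
    by (simp add: erlang_B_def)
  also have "\<dots> = (\<Sum>k\<le>s. (l ^ k / fact k) / (l ^ s / fact s))"
    by (rule sum_divide_distrib)
  also have "\<dots> = (\<Sum>j\<le>s. (l ^ (s - j) / fact (s - j)) / (l ^ s / fact s))"
    by (rule sum.reindex_bij_witness[of _ "\<lambda>j. s - j" "\<lambda>j. s - j"]) auto
  also have "\<dots> = (\<Sum>j\<le>s. erlang_term \<gamma> s j)"
    using reversed by (intro sum.cong) auto
  finally show ?thesis by (simp add: l_def)
qed

text \<open>
  The factor with \<open>i = s\<close> vanishes. So the value of the step function below at \<open>y\<close> is given by
  a single formula, without a case distinction at the end of the sum.
\<close>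

lemma erlang_term_eq_0:
  assumes "s > 0" "s < j"
  shows "erlang_term \<gamma> s j = 0"
proof -
  have "(\<Prod>i<j. 1 - real i / real s) = 0"
    using assms by (intro prod_zero) (auto intro!: bexI[of _ s])
  then show ?thesis by (simp add: erlang_term_def)
qed

definition erlang_step :: "real \<Rightarrow> nat \<Rightarrow> real \<Rightarrow> real" where
  "erlang_step \<gamma> s y =
    (\<Sum>j\<le>s. erlang_term \<gamma> s j * indicator {real j / sqrt (real s)..<real (Suc j) / sqrt (real s)} y)"

lemma borel_measurable_erlang_step [measurable]: "erlang_step \<gamma> s \<in> borel_measurable borel"
  unfolding erlang_step_def by measurable

lemma integral_erlang_step:
  assumes s: "s > 0"
  shows "(LINT y|lborel. erlang_step \<gamma> s y) = (\<Sum>j\<le>s. erlang_term \<gamma> s j) / sqrt (real s)"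
proof -
  have "(LINT y|lborel. erlang_step \<gamma> s y) =
      (\<Sum>j\<le>s. erlang_term \<gamma> s j * measure lborel {real j / sqrt (real s)..<real (Suc j) / sqrt (real s)})"
    unfolding erlang_step_def by (subst Bochner_Integration.integral_sum)
       (auto intro!: integrable_mult_right integrable_real_indicator simp: divide_right_mono)
  also have "\<dots> = (\<Sum>j\<le>s. erlang_term \<gamma> s j / sqrt (real s))"
    by (intro sum.cong refl) (use s in \<open>auto simp: divide_right_mono diff_divide_distrib[symmetric]\<close>)
  finally show ?thesis by (simp add: sum_divide_distrib)
qed

lemma erlang_step_eq:
  assumes s: "s > 0" and y: "0 \<le> y"
  shows "erlang_step \<gamma> s y = erlang_term \<gamma> s (nat \<lfloor>y * sqrt (real s)\<rfloor>)"
proof -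
  let ?k = "nat \<lfloor>y * sqrt (real s)\<rfloor>"
  have "indicator {real j / sqrt (real s)..<real (Suc j) / sqrt (real s)} y = (if j = ?k then 1 else 0 :: real)" for j
  proof -
    have "y \<in> {real j / sqrt (real s)..<real (Suc j) / sqrt (real s)} \<longleftrightarrow>
        real j \<le> y * sqrt (real s) \<and> y * sqrt (real s) < real j + 1"
      using s by (simp add: field_simps)
    also have "\<dots> \<longleftrightarrow> \<lfloor>y * sqrt (real s)\<rfloor> = int j"
      by (simp add: floor_eq_iff)
    also have "\<dots> \<longleftrightarrow> j = ?k"
      using y by auto
    finally show ?thesis by (simp add: indicator_def)
  qed
  then have "erlang_step \<gamma> s y = (\<Sum>j\<le>s. if j = ?k then erlang_term \<gamma> s j else 0)"
    unfolding erlang_step_def by (intro sum.cong) auto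
  also have "\<dots> = erlang_term \<gamma> s ?k"
    using erlang_term_eq_0[OF s, of ?k \<gamma>] by auto
  finally show ?thesis .
qed

lemma erlang_step_neg:
  assumes "y < 0"
  shows "erlang_step \<gamma> s y = 0"
proof -
  have "y < real j / sqrt (real s)" for j
    by (rule less_le_trans[OF assms]) simp
  then show ?thesis
    unfolding erlang_step_def by (intro sum.neutral) (auto simp: indicator_def not_le)
qed

section \<open>The limit of the step functions\<close>

lemma sum_lessThan_div:
  fixes c :: real
  shows "(\<Sum>i<j. real i / c) = real j * (real j - 1) / (2 * c)"
proof -
  have "(\<Sum>i<j. real i) = real j * (real j - 1) / 2"
    by (induction j) (auto simp: field_simps)
  then have "(\<Sum>i<j. real i / c) = real j * (real j - 1) / 2 / c"
    by (simp only: sum_divide_distrib[symmetric])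
  then show ?thesis by simp
qed

lemma prod_one_minus_le_exp:
  assumes "j \<le> s"
  shows "(\<Prod>i<j. 1 - real i / real s) \<le> exp (- (real j * (real j - 1) / (2 * real s)))"
proof -
  have "(\<Prod>i<j. 1 - real i / real s) \<le> (\<Prod>i<j. exp (- (real i / real s)))"
    using assms exp_ge_add_one_self[of "- (real i / real s)" for i]
    by (intro prod_mono) (auto simp: divide_le_eq)
  also have "\<dots> = exp (- (\<Sum>i<j. real i / real s))"
    by (simp add: exp_sum sum_negf[symmetric])
  finally show ?thesis unfolding sum_lessThan_div .
qed

text \<open>
  The matching lower bound, from the second order bound of the logarithm. Its error term
  \<open>j\<^sup>3 / s\<^sup>2\<close> tends to 0 when \<open>j\<close> grows like \<open>\<surd>s\<close>.
\<close>

lemma exp_le_prod_one_minus: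
  assumes "2 * j \<le> s"
  shows "exp (- (real j * (real j - 1) / (2 * real s)) - 2 * (real j ^ 3 / real s ^ 2))
    \<le> (\<Prod>i<j. 1 - real i / real s)"
proof -
  have "(\<Sum>i<j. (real i / real s)\<^sup>2) \<le> (\<Sum>i<j. (real j / real s)\<^sup>2)"
    by (intro sum_mono power_mono divide_right_mono) auto
  also have "\<dots> = real j ^ 3 / real s ^ 2"
    by (simp add: power_divide power2_eq_square power3_eq_cube)
  finally have sq: "(\<Sum>i<j. (real i / real s)\<^sup>2) \<le> real j ^ 3 / real s ^ 2" .
  have "exp (- (real j * (real j - 1) / (2 * real s)) - 2 * (real j ^ 3 / real s ^ 2))
      \<le> exp (\<Sum>i<j. - (real i / real s) - 2 * (real i / real s)\<^sup>2)"
    using sq unfolding sum_subtractf sum_negf sum_lessThan_div by (simp add: sum_distrib_left[symmetric])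
  also have "\<dots> = (\<Prod>i<j. exp (- (real i / real s) - 2 * (real i / real s)\<^sup>2))"
    by (simp add: exp_sum)
  also have "\<dots> \<le> (\<Prod>i<j. 1 - real i / real s)"
  proof (intro prod_mono conjI)
    fix i assume "i \<in> {..<j}"
    then have i: "0 \<le> real i / real s" "real i / real s \<le> 1 / 2"
      using assms by (auto simp: field_simps)
    have "- (real i / real s) - 2 * (real i / real s)\<^sup>2 \<le> ln (1 - real i / real s)"
      by (rule ln_one_minus_pos_lower_bound[OF i])
    moreover have "0 < 1 - real i / real s" using i by linarith
    ultimately show "exp (- (real i / real s) - 2 * (real i / real s)\<^sup>2) \<le> 1 - real i / real s"
      by (simp only: ln_ge_iff)
  qed auto
  finally show ?thesis .
qed

lemma tendsto_floor_over_sqrt: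
  assumes y: "0 \<le> y"
  shows "(\<lambda>s. real (nat \<lfloor>y * sqrt (real s)\<rfloor>) / sqrt (real s)) \<longlonglongrightarrow> y"
proof (rule real_tendsto_sandwich)
  show "(\<lambda>s. y - 1 / sqrt (real s)) \<longlonglongrightarrow> y" by real_asymp
  show "\<forall>\<^sub>F s in sequentially. y - 1 / sqrt (real s) \<le> real (nat \<lfloor>y * sqrt (real s)\<rfloor>) / sqrt (real s)"
    using eventually_gt_at_top[of 0]
  proof eventually_elim
    case (elim s)
    have "y * sqrt (real s) - 1 \<le> real (nat \<lfloor>y * sqrt (real s)\<rfloor>)" using y by linarith
    then have "(y * sqrt (real s) - 1) / sqrt (real s) \<le> real (nat \<lfloor>y * sqrt (real s)\<rfloor>) / sqrt (real s)"
      by (rule divide_right_mono) simp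
    then show ?case using elim by (simp add: diff_divide_distrib)
  qed
  show "\<forall>\<^sub>F s in sequentially. real (nat \<lfloor>y * sqrt (real s)\<rfloor>) / sqrt (real s) \<le> y"
    using eventually_gt_at_top[of 0]
  proof eventually_elim
    case (elim s)
    have "real (nat \<lfloor>y * sqrt (real s)\<rfloor>) \<le> y * sqrt (real s)" using y by simp
    then show ?case using elim by (simp add: field_simps)
  qed
qed auto

text \<open>
  The two bounds on the product squeeze the numerator to \<open>exp (- y\<^sup>2 / 2)\<close>; the denominator tends to
  \<open>exp (- \<gamma> y)\<close> by compound interest.
\<close>

lemma erlang_term_tendsto:
  fixes k :: "nat \<Rightarrow> nat"
  assumes lim: "(\<lambda>s. real (k s) / sqrt (real s)) \<longlonglongrightarrow> y"
  shows "(\<lambda>s. erlang_term \<gamma> s (k s)) \<longlonglongrightarrow> exp (\<gamma> * y - y\<^sup>2 / 2)"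
proof -
  let ?r = "\<lambda>s. real (k s) / sqrt (real s)"
  have inv: "(\<lambda>s. 1 / sqrt (real s)) \<longlonglongrightarrow> 0" by real_asymp
  have "(\<lambda>s. ?r s * (1 / sqrt (real s))) \<longlonglongrightarrow> y * 0"
    by (intro tendsto_mult lim inv)
  then have "\<forall>\<^sub>F s in sequentially. ?r s * (1 / sqrt (real s)) < 1 / 2"
    by (rule order_tendstoD) auto
  with eventually_gt_at_top[of 0] have half: "\<forall>\<^sub>F s in sequentially. s > 0 \<and> 2 * k s \<le> s"
  proof eventually_elim
    case (elim s)
    then have "real (k s) < real s / 2" by (simp add: field_simps)
    with elim show ?case by simp
  qed
  have quad: "real (k s) * (real (k s) - 1) / (2 * real s) = ?r s * (?r s - 1 / sqrt (real s)) / 2"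
    if "s > 0" for s
    using that by (simp add: field_simps)
  have cube: "real (k s) ^ 3 / real s ^ 2 = ?r s ^ 3 * (1 / sqrt (real s))" if "s > 0" for s
  proof -
    have "real s ^ 2 = sqrt (real s) ^ 4"
      by (simp add: power4_eq_xxxx power2_eq_square mult.assoc)
    then show ?thesis using that by (simp add: power_divide power3_eq_cube power4_eq_xxxx)
  qed
  have "(\<lambda>s. \<Prod>i<k s. 1 - real i / real s) \<longlonglongrightarrow> exp (- (y * (y - 0) / 2))"
  proof (rule real_tendsto_sandwich)
    have "(\<lambda>s. exp (- (?r s * (?r s - 1 / sqrt (real s)) / 2) - 2 * (?r s ^ 3 * (1 / sqrt (real s)))))
        \<longlonglongrightarrow> exp (- (y * (y - 0) / 2) - 2 * (y ^ 3 * 0))"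
      by (intro tendsto_intros lim inv) auto
    then show "(\<lambda>s. exp (- (?r s * (?r s - 1 / sqrt (real s)) / 2) - 2 * (?r s ^ 3 * (1 / sqrt (real s)))))
        \<longlonglongrightarrow> exp (- (y * (y - 0) / 2))" by simp
    show "\<forall>\<^sub>F s in sequentially. exp (- (?r s * (?r s - 1 / sqrt (real s)) / 2) - 2 * (?r s ^ 3 * (1 / sqrt (real s))))
        \<le> (\<Prod>i<k s. 1 - real i / real s)"
      using half
    proof eventually_elim
      case (elim s)
      then show ?case
        using exp_le_prod_one_minus[of "k s" s] by (simp only: quad cube)
    qed
    show "\<forall>\<^sub>F s in sequentially. (\<Prod>i<k s. 1 - real i / real s)
        \<le> exp (- (?r s * (?r s - 1 / sqrt (real s)) / 2))"
      using half
    proof eventually_elim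
      case (elim s)
      then show ?case
        using prod_one_minus_le_exp[of "k s" s] by (simp only: quad) simp
    qed
    show "(\<lambda>s. exp (- (?r s * (?r s - 1 / sqrt (real s)) / 2))) \<longlonglongrightarrow> exp (- (y * (y - 0) / 2))"
      by (intro tendsto_intros lim inv) auto
  qed
  moreover have "(\<lambda>s. (1 - \<gamma> / sqrt (real s)) ^ k s) \<longlonglongrightarrow> exp (y * - \<gamma>)"
  proof -
    have "(\<lambda>s. sqrt (real s) * ln (1 - \<gamma> / sqrt (real s))) \<longlonglongrightarrow> - \<gamma>" by real_asymp
    then have "(\<lambda>s. exp (?r s * (sqrt (real s) * ln (1 - \<gamma> / sqrt (real s))))) \<longlonglongrightarrow> exp (y * - \<gamma>)"
      by (intro tendsto_intros lim)
    moreover have "\<forall>\<^sub>F s in sequentially. 1 - \<gamma> / sqrt (real s) > 0" by real_asymp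
    then have "\<forall>\<^sub>F s in sequentially. exp (?r s * (sqrt (real s) * ln (1 - \<gamma> / sqrt (real s))))
        = (1 - \<gamma> / sqrt (real s)) ^ k s"
      using eventually_gt_at_top[of 0]
      by eventually_elim (simp add: exp_of_nat_mult)
    ultimately show ?thesis by (rule Lim_transform_eventually)
  qed
  ultimately have "(\<lambda>s. erlang_term \<gamma> s (k s)) \<longlonglongrightarrow> exp (- (y * (y - 0) / 2)) / exp (y * - \<gamma>)"
    unfolding erlang_term_def by (intro tendsto_divide) auto
  then show ?thesis by (simp add: exp_diff[symmetric] power2_eq_square algebra_simps)
qed

lemma erlang_step_tendsto:
  "(\<lambda>s. erlang_step \<gamma> s y) \<longlonglongrightarrow> indicator {0..} y * exp (\<gamma> * y - y\<^sup>2 / 2)"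
proof (cases "0 \<le> y")
  case True
  have "(\<lambda>s. erlang_term \<gamma> s (nat \<lfloor>y * sqrt (real s)\<rfloor>)) \<longlonglongrightarrow> exp (\<gamma> * y - y\<^sup>2 / 2)"
    by (rule erlang_term_tendsto[OF tendsto_floor_over_sqrt[OF True]])
  moreover have "\<forall>\<^sub>F s in sequentially. erlang_term \<gamma> s (nat \<lfloor>y * sqrt (real s)\<rfloor>) = erlang_step \<gamma> s y"
    using eventually_gt_at_top[of 0] by eventually_elim (simp add: erlang_step_eq True)
  ultimately show ?thesis using True by (auto dest: Lim_transform_eventually)
qed (simp add: erlang_step_neg)

text \<open>
  One integrable bound for all large \<open>s\<close>. With \<open>r = \<surd>s\<close> and \<open>j\<close> the integer part of \<open>y r\<close>, the base
  \<open>1 - \<gamma> / r\<close> is at least \<open>exp (- 2 \<bar>\<gamma>\<bar> / r)\<close> as soon as \<open>\<bar>\<gamma>\<bar> / r \<le> 1 / 2\<close>, which costs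
  \<open>2 \<bar>\<gamma>\<bar> y\<close> in the exponent. Replacing \<open>j (j - 1)\<close> by \<open>(y r)\<^sup>2\<close> costs at most \<open>3 y r\<close>, that is
  \<open>3 y / (2 r) \<le> 3 y / 2\<close> in the exponent.
\<close>

lemma erlang_step_bound:
  assumes s: "s > 0" and g: "2 * \<bar>\<gamma>\<bar> \<le> sqrt (real s)"
  shows "norm (erlang_step \<gamma> s y) \<le> indicator {0..} y * exp ((2 * \<bar>\<gamma>\<bar> + 3 / 2) * y - y\<^sup>2 / 2)"
proof (cases "0 \<le> y")
  case True
  define r where "r = sqrt (real s)"
  define j where "j = nat \<lfloor>y * r\<rfloor>"
  have r: "1 \<le> r" "real s = r\<^sup>2" using s by (auto simp: r_def)
  have j: "real j \<le> y * r" "y * r < real j + 1"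
    using True r by (auto simp: j_def)
  have step: "erlang_step \<gamma> s y = erlang_term \<gamma> s j"
    using erlang_step_eq[OF s True] by (simp add: j_def r_def)
  show ?thesis
  proof (cases "j \<le> s")
    case False
    then show ?thesis using erlang_term_eq_0[OF s] by (simp add: step)
  next
    case js: True
    have x: "\<bar>\<gamma>\<bar> / r \<le> 1 / 2" "0 \<le> \<bar>\<gamma>\<bar> / r"
      using g r by (auto simp: r_def[symmetric] field_simps)
    have base: "exp (- 2 * (\<bar>\<gamma>\<bar> / r)) \<le> 1 - \<gamma> / r"
    proof -
      have "- (\<bar>\<gamma>\<bar> / r) - 2 * (\<bar>\<gamma>\<bar> / r)\<^sup>2 \<le> ln (1 - \<bar>\<gamma>\<bar> / r)"
        by (rule ln_one_minus_pos_lower_bound) (use x in auto)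
      moreover have "2 * (\<bar>\<gamma>\<bar> / r)\<^sup>2 \<le> \<bar>\<gamma>\<bar> / r"
        using mult_right_mono[OF x] by (simp add: power2_eq_square)
      ultimately have "- 2 * (\<bar>\<gamma>\<bar> / r) \<le> ln (1 - \<bar>\<gamma>\<bar> / r)" by linarith
      moreover have "0 < 1 - \<bar>\<gamma>\<bar> / r" using x(1) by linarith
      ultimately have "exp (- 2 * (\<bar>\<gamma>\<bar> / r)) \<le> 1 - \<bar>\<gamma>\<bar> / r"
        by (simp only: ln_ge_iff)
      also have "\<dots> \<le> 1 - \<gamma> / r" using r by (simp add: divide_right_mono)
      finally show ?thesis .
    qed
    have "exp (- (2 * \<bar>\<gamma>\<bar> * y)) \<le> exp (real j * (- 2 * (\<bar>\<gamma>\<bar> / r)))"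
    proof -
      have "real j / r \<le> y" using j r by (simp add: field_simps)
      from mult_left_mono[OF this, of "2 * \<bar>\<gamma>\<bar>"] show ?thesis by (simp add: algebra_simps)
    qed
    also have "\<dots> = exp (- 2 * (\<bar>\<gamma>\<bar> / r)) ^ j" by (rule exp_of_nat_mult)
    also have "\<dots> \<le> (1 - \<gamma> / r) ^ j" by (intro power_mono base) auto
    finally have den: "exp (- (2 * \<bar>\<gamma>\<bar> * y)) \<le> (1 - \<gamma> / r) ^ j" .
    have num0: "0 \<le> (\<Prod>i<j. 1 - real i / real s)"
      using js by (intro prod_nonneg) (auto simp: divide_le_eq)
    \<comment> \<open>Writing \<open>y r = j + d\<close> with \<open>0 \<le> d \<le> 1\<close>, this amounts to \<open>2 j d + d\<^sup>2 \<le> 2 j + 3 d\<close>.\<close>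
    have "(y * r)\<^sup>2 - 3 * (y * r) \<le> real j * (real j - 1)"
    proof -
      define d where "d = y * r - real j"
      have d: "0 \<le> d" "d \<le> 1" using j by (auto simp: d_def)
      have "d\<^sup>2 \<le> d" using mult_right_mono[OF d(2,1)] by (simp add: power2_eq_square)
      moreover have "real j * d \<le> real j" using mult_left_mono[OF d(2), of "real j"] by simp
      moreover have "y * r = real j + d" by (simp add: d_def)
      ultimately show ?thesis using d by (simp add: power2_eq_square algebra_simps)
    qed
    then have "((y * r)\<^sup>2 - 3 * (y * r)) / (2 * real s) \<le> real j * (real j - 1) / (2 * real s)"
      by (intro divide_right_mono) auto
    moreover have "((y * r)\<^sup>2 - 3 * (y * r)) / (2 * real s) = y\<^sup>2 / 2 - 3 / 2 * (y / r)"
      using r by (simp add: field_simps power2_eq_square)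
    moreover have "y / r \<le> y" using divide_left_mono[of 1 r y] True r by simp
    ultimately have "- (real j * (real j - 1) / (2 * real s)) \<le> 3 / 2 * y - y\<^sup>2 / 2" by argo
    then have "(\<Prod>i<j. 1 - real i / real s) \<le> exp (3 / 2 * y - y\<^sup>2 / 2)"
      using prod_one_minus_le_exp[OF js] by (meson exp_le_cancel_iff order_trans)
    then have "erlang_term \<gamma> s j \<le> exp (3 / 2 * y - y\<^sup>2 / 2) / exp (- (2 * \<bar>\<gamma>\<bar> * y))"
      unfolding erlang_term_def r_def[symmetric] by (intro frac_le den) auto
    moreover have "0 \<le> erlang_term \<gamma> s j"
      unfolding erlang_term_def r_def[symmetric]
      using num0 order_trans[OF exp_ge_zero den] by simp
    ultimately show ?thesis
      using True by (simp add: step exp_diff[symmetric] algebra_simps)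
  qed
qed (simp add: erlang_step_neg)

section \<open>The Gaussian integral and the limit of the Erlang B function\<close>

lemma exp_eq_std_normal_density:
  "exp (a * y - y\<^sup>2 / 2) = std_normal_density (a - y) / std_normal_density a"
  unfolding std_normal_density_def
  by (simp add: exp_diff[symmetric] power2_eq_square field_simps)

lemma integrable_half_gaussian:
  "integrable lborel (\<lambda>y::real. indicator {0..} y * exp (a * y - y\<^sup>2 / 2))"
proof -
  have "integrable lborel (\<lambda>y. std_normal_density (a + (-1) * y))"
    by (subst lborel_integrable_real_affine_iff) auto
  then have "integrable lborel (\<lambda>y::real. exp (a * y - y\<^sup>2 / 2))"
    unfolding exp_eq_std_normal_density by simp
  then have "set_integrable lborel {0..} (\<lambda>y::real. exp (a * y - y\<^sup>2 / 2))"
    unfolding set_integrable_def by (rule integrable_mult_indicator[rotated]) auto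
  then show ?thesis by (simp add: set_integrable_def)
qed

text \<open>
  By \<open>exp_eq_std_normal_density\<close> the integrand is a reflected normal density, up to a constant; the
  substitution \<open>x = a - y\<close> turns the half line into \<open>{..a}\<close>.
\<close>

lemma integral_half_gaussian:
  "(LINT y|lborel. indicator {0..} y * exp (a * y - y\<^sup>2 / 2)) =
    cdf std_normal_distribution a / std_normal_density a"
proof -
  have "cdf std_normal_distribution a = (LINT x|std_normal_distribution. indicator {..a} x)"
    by (simp add: cdf_def)
  also have "\<dots> = (LINT x|lborel. std_normal_density x * indicator {..a} x)"
    by (subst integral_density) auto
  also have "\<dots> = (LINT y|lborel. std_normal_density (a + (-1) * y) * indicator {..a} (a + (-1) * y))"
    by (subst lborel_integral_real_affine[where c = "-1" and t = a]) auto
  also have "\<dots> = (LINT y|lborel. indicator {0..} y * exp (a * y - y\<^sup>2 / 2) * std_normal_density a)"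
    unfolding exp_eq_std_normal_density
    by (intro Bochner_Integration.integral_cong) (auto simp: indicator_def std_normal_density_def)
  also have "\<dots> = (LINT y|lborel. indicator {0..} y * exp (a * y - y\<^sup>2 / 2)) * std_normal_density a"
    by simp
  finally show ?thesis by (simp add: std_normal_density_def)
qed

text \<open>
  The limit of the denominators is not 0. The integral over \<open>[0,1]\<close> alone is positive, as the integrand
  is at least \<open>exp (- \<bar>a\<bar> - 1 / 2)\<close> there.
\<close>

lemma cdf_std_normal_pos: "0 < cdf std_normal_distribution a"
proof -
  have "0 < (LINT y|lborel. indicator {0..} y * exp (a * y - y\<^sup>2 / 2))"
  proof -
    have "exp (- \<bar>a\<bar> - 1 / 2) = (LINT y|lborel. indicator {0..1::real} y * exp (- \<bar>a\<bar> - 1 / 2))"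
      by (simp add: content_real)
    also have "\<dots> \<le> (LINT y|lborel. indicator {0..} y * exp (a * y - y\<^sup>2 / 2))"
    proof (intro integral_mono integrable_half_gaussian integrable_mult_left integrable_real_indicator)
      fix y :: real
      have "- \<bar>a\<bar> - 1 / 2 \<le> a * y - y\<^sup>2 / 2" if "0 \<le> y" "y \<le> 1"
      proof -
        have "y\<^sup>2 \<le> 1" using that by (simp add: power_le_one)
        moreover have "\<bar>a * y\<bar> \<le> \<bar>a\<bar> * 1"
          unfolding abs_mult using that by (intro mult_left_mono) auto
        ultimately show ?thesis by linarith
      qed
      then show "indicator {0..1} y * exp (- \<bar>a\<bar> - 1 / 2) \<le> indicator {0..} y * exp (a * y - y\<^sup>2 / 2)"
        by (auto simp: indicator_def)
    qed auto
    finally show ?thesis by (rule less_le_trans[OF exp_gt_zero])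
  qed
  then show ?thesis
    using normal_density_pos[of 1 0 a] unfolding integral_half_gaussian by (auto simp: zero_less_divide_iff)
qed

lemma inverse_erlang_B_over_sqrt_tendsto:
  "(\<lambda>s. inverse (erlang_B s (real s - \<gamma> * sqrt (real s))) / sqrt (real s))
    \<longlonglongrightarrow> cdf std_normal_distribution \<gamma> / std_normal_density \<gamma>"
proof -
  have big: "\<forall>\<^sub>F s in sequentially. s > 0 \<and> 2 * \<bar>\<gamma>\<bar> \<le> sqrt (real s) \<and> \<gamma> < sqrt (real s)"
    by (intro eventually_conj eventually_gt_at_top) real_asymp+
  then obtain N where N: "\<And>s. s \<ge> N \<Longrightarrow> s > 0 \<and> 2 * \<bar>\<gamma>\<bar> \<le> sqrt (real s) \<and> \<gamma> < sqrt (real s)"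
    by (auto simp: eventually_at_top_linorder)
  \<comment> \<open>The bound holds for large \<open>s\<close> only, but dominated convergence wants it for every member of the
    sequence; hence the shift by \<open>N\<close>.\<close>
  have "(\<lambda>s. LINT y|lborel. erlang_step \<gamma> (s + N) y)
      \<longlonglongrightarrow> (LINT y|lborel. indicator {0..} y * exp (\<gamma> * y - y\<^sup>2 / 2))"
  proof (rule integral_dominated_convergence)
    show "integrable lborel (\<lambda>y::real. indicator {0..} y * exp ((2 * \<bar>\<gamma>\<bar> + 3 / 2) * y - y\<^sup>2 / 2))"
      by (rule integrable_half_gaussian)
    show "AE y in lborel. (\<lambda>s. erlang_step \<gamma> (s + N) y) \<longlonglongrightarrow> indicator {0..} y * exp (\<gamma> * y - y\<^sup>2 / 2)"
      by (intro AE_I2 LIMSEQ_ignore_initial_segment erlang_step_tendsto)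
    show "AE y in lborel. norm (erlang_step \<gamma> (s + N) y)
        \<le> indicator {0..} y * exp ((2 * \<bar>\<gamma>\<bar> + 3 / 2) * y - y\<^sup>2 / 2)" for s
      using N[of "s + N"] by (intro AE_I2 erlang_step_bound) auto
  qed measurable
  then have "(\<lambda>s. LINT y|lborel. erlang_step \<gamma> s y)
      \<longlonglongrightarrow> cdf std_normal_distribution \<gamma> / std_normal_density \<gamma>"
    unfolding integral_half_gaussian by (rule LIMSEQ_offset)
  moreover have "\<forall>\<^sub>F s in sequentially. (LINT y|lborel. erlang_step \<gamma> s y)
      = inverse (erlang_B s (real s - \<gamma> * sqrt (real s))) / sqrt (real s)"
    using big by eventually_elim (simp add: integral_erlang_step inverse_erlang_B_eq_sum)
  ultimately show ?thesis by (rule Lim_transform_eventually)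
qed

section \<open>The delay and rejection probabilities\<close>

theorem theorem3:
  fixes q :: "nat \<Rightarrow> real" and \<gamma> :: real
  assumes "\<And>n. 0 \<le> q n \<and> q n \<le> 1"
    and "0 \<le> adm_P q" and "adm_P q < 1"
    and "filterlim (adm_F q) at_top (at_left_radius q)"
  shows "(\<lambda>s. sqrt (real s) * D_F q s (real s - \<gamma> * sqrt (real s)))
           \<longlonglongrightarrow> (1 + adm_F q 1) * (std_normal_density \<gamma> / cdf std_normal_distribution \<gamma>)
         \<and> (\<lambda>s. sqrt (real s) * D_F_R q s (real s - \<gamma> * sqrt (real s)))
           \<longlonglongrightarrow> std_normal_density \<gamma> / cdf std_normal_distribution \<gamma>"
proof -
  define L where "L = (\<lambda>s. real s - \<gamma> * sqrt (real s))"
  define b where "b = (\<lambda>s. inverse (erlang_B s (L s)) / sqrt (real s))"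
  define f where "f = (\<lambda>s. adm_F q (L s / real s))"
  have b: "b \<longlonglongrightarrow> cdf std_normal_distribution \<gamma> / std_normal_density \<gamma>"
    unfolding b_def L_def by (rule inverse_erlang_B_over_sqrt_tendsto)
  have "(\<lambda>s. L s / real s) \<longlonglongrightarrow> 1" unfolding L_def by real_asymp
  then have f: "f \<longlonglongrightarrow> adm_F q 1"
    unfolding f_def by (rule isCont_tendsto_compose[OF isCont_adm_F_1[OF assms(1-3)]])
  have inv: "(\<lambda>s. 1 / sqrt (real s)) \<longlonglongrightarrow> 0" by real_asymp
  have ratio: "(\<lambda>s. 1 - real s / L s) \<longlonglongrightarrow> 0" unfolding L_def by real_asymp
  have lim: "cdf std_normal_distribution \<gamma> / std_normal_density \<gamma> + adm_F q 1 * 0 \<noteq> 0"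
    using cdf_std_normal_pos[of \<gamma>] by (simp add: std_normal_density_def)
  have ev: "\<forall>\<^sub>F s in sequentially. s > 0 \<and> L s \<noteq> 0"
  proof -
    have "\<forall>\<^sub>F s in sequentially. L s > 0" unfolding L_def by real_asymp
    with eventually_gt_at_top[of 0] show ?thesis by eventually_elim auto
  qed
  \<comment> \<open>With \<open>r = \<surd>s\<close> and \<open>e\<close> the reciprocal Erlang B value, both \<open>e / r\<close> and \<open>1 / r\<close> converge.\<close>
  have cancel: "r * (x / (e + y)) = x / (e / r + y * (1 / r))" if "r > 0" for r x e y :: real
    using that by (simp add: add_divide_distrib[symmetric])
  have "(\<lambda>s. (1 + f s) / (b s + f s * (1 / sqrt (real s))))
      \<longlonglongrightarrow> (1 + adm_F q 1) / (cdf std_normal_distribution \<gamma> / std_normal_density \<gamma> + adm_F q 1 * 0)"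
    by (intro tendsto_intros b f inv lim)
  moreover have "\<forall>\<^sub>F s in sequentially. (1 + f s) / (b s + f s * (1 / sqrt (real s)))
      = sqrt (real s) * D_F q s (L s)"
    using ev by eventually_elim (simp only: D_F_def f_def b_def cancel real_sqrt_gt_0_iff of_nat_0_less_iff if_False)
  ultimately have D: "(\<lambda>s. sqrt (real s) * D_F q s (L s)) \<longlonglongrightarrow>
      (1 + adm_F q 1) / (cdf std_normal_distribution \<gamma> / std_normal_density \<gamma> + adm_F q 1 * 0)"
    by (rule Lim_transform_eventually)
  have "(\<lambda>s. (1 + (1 - real s / L s) * f s) / (b s + f s * (1 / sqrt (real s))))
      \<longlonglongrightarrow> (1 + 0 * adm_F q 1) / (cdf std_normal_distribution \<gamma> / std_normal_density \<gamma> + adm_F q 1 * 0)"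
    by (intro tendsto_add tendsto_mult tendsto_divide tendsto_const ratio b f inv lim)
  moreover have "\<forall>\<^sub>F s in sequentially. (1 + (1 - real s / L s) * f s) / (b s + f s * (1 / sqrt (real s)))
      = sqrt (real s) * D_F_R q s (L s)"
    using ev by eventually_elim (simp only: D_F_R_def f_def b_def cancel real_sqrt_gt_0_iff of_nat_0_less_iff if_False)
  ultimately have "(\<lambda>s. sqrt (real s) * D_F_R q s (L s)) \<longlonglongrightarrow>
      (1 + 0 * adm_F q 1) / (cdf std_normal_distribution \<gamma> / std_normal_density \<gamma> + adm_F q 1 * 0)"
    by (rule Lim_transform_eventually)
  with D show ?thesis by (simp add: L_def)
qed

end
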